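(* Let $n\ge 1$. Every strict inclusion chain in the poset $\mathcal J_n$ has length at most $2$; that is, if $X_0\subsetneq X_1\subsetneq\cdots\subsetneq X_r$ with all $X_i\in\mathcal J_n$, then $r\le 2$. Equivalently, the order complex $\Delta(\mathcal J_n)$ satisfies $\dim\Delta(\mathcal J_n)\le 2$.
   Context: A partition of $n$ is a weakly decreasing sequence $\lambda=(\lambda_1\ge\cdots\ge\lambda_\ell>0)$ of positive integers with sum $n$, identified with its Ferrers diagram ($\lambda_i$ left-justified cells in row $i$); set $\lambda_{\ell+1}=0$. The partition graph $G_n$ has as vertices all partitions of $n$; two distinct partitions are adjacent if one is obtained from the other by removing one cell from a row, adding it to another row (possibly a new row of length $0$), and reordering the row lengths into weakly decreasing order. $K_n$ is the clique complex of $G_n$: its simplices are the finite nonempty cliques of $G_n$. A removable corner of $\lambda$ is the last cell of a row whose length is strictly greater than that of the next row; an addable corner is a position where a cell can be added so that the result is again a Ferrers diagram of a partition (row $\ell+1$ allowed). Write $r(\cdot)$ for the row number of a corner. For a removable corner $c$ and an addable corner $a$ of $\lambda$ with $r(c)\ne r(a)$, remove $c$ (decrease $\lambda_{r(c)}$ by $1$), add a cell at $a$ (increase $\lambda_{r(a)}$ by $1$), and reorder row lengths. If the result is a partition of $n$ different from $\lambda$, the transfer is called admissible and the result is denoted $\lambda(c\to a)$. The neighbors of $\lambda$ in $G_n$ are exactly the partitions $\lambda(c\to a)$ for admissible transfers. For a removable corner $c$ of $\lambda$, the full star-simplex is $\Sigma^{\mathrm{star}}_{\max}(\lambda,c):=\{\lambda\}\cup\{\lambda(c\to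 a):a \text{ with } \lambda(c\to a)\text{ admissible}\}$. For an addable corner $a$ of $\lambda$, the full top-simplex is $\Sigma^{\mathrm{top}}_{\max}(\lambda,a):=\{\lambda\}\cup\{\lambda(c\to a):c\text{ with }\lambda(c\to a)\text{ admissible}\}$. These are simplices of $K_n$. $\mathcal C_n$ is the set of all full star- and full top-simplices over all partitions $\lambda$ of $n$ and all their corners, with equal simplices identified. For each partition $\lambda$ of $n$, put $A_\lambda:=\{U\in\mathcal C_n:\lambda\in U\}$, and for each nonempty simplex $S$ of $K_n$ put $A_S:=\bigcap_{\lambda\in S}A_\lambda$. The poset $\mathcal J_n:=\{A_S: S\text{ a nonempty simplex of }K_n\}$ (equal intersections identified) is ordered by inclusion. The order complex $\Delta(P)$ of a poset $P$ is the simplicial complex of its finite nonempty chains. *)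

theory Defs
  imports Complex_Main "HOL-Library.Extended_Real"
begin

type_synonym cell = "nat \<times> nat"

definition partitions :: "nat \<Rightarrow> nat list set" where
  "partitions n = {lam. sorted_wrt (\<ge>) lam \<and> (\<forall>x \<in> set lam. 0 < x) \<and> sum_list lam = n}"

text \<open>Rows and columns are numbered from 1; rows beyond the last one have length 0.\<close>

definition row_len :: "nat list \<Rightarrow> nat \<Rightarrow> nat" where
  "row_len lam i = (if 1 \<le> i \<and> i \<le> length lam then lam ! (i - 1) else 0)"

definition ferrers :: "nat list \<Rightarrow> cell set" where
  "ferrers lam = {(i, j). 1 \<le> i \<and> i \<le> length lam \<and> 1 \<le> j \<and> j \<le> row_len lam i}"

text \<open>
  Move one cell from row \<open>i\<close> to row \<open>j\<close> and reorder the row lengths. Row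
  \<open>length lam + 1\<close> is the possible new row, and rows of length 0 are dropped from the
  result. Only meant for \<open>i \<noteq> j\<close>, \<open>1 \<le> i \<le> length lam\<close>, \<open>1 \<le> j \<le> length lam + 1\<close>.
\<close>

definition move_cell :: "nat list \<Rightarrow> nat \<Rightarrow> nat \<Rightarrow> nat list" where
  "move_cell lam i j =
     rev (sort (filter (\<lambda>x. 0 < x)
       (map (\<lambda>k. if k = i then row_len lam k - 1
                 else if k = j then row_len lam k + 1
                 else row_len lam k) [1..<length lam + 2])))"

definition obtained_from :: "nat list \<Rightarrow> nat list \<Rightarrow> bool" where
  "obtained_from lam mu \<longleftrightarrow>
     (\<exists>i j. i \<in> {1..length lam} \<and> j \<in> {1..length lam + 1} \<and> i \<noteq> j \<and> mu = move_cell lam i j)"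

definition adjacent :: "nat \<Rightarrow> nat list \<Rightarrow> nat list \<Rightarrow> bool" where
  "adjacent n lam mu \<longleftrightarrow> lam \<in> partitions n \<and> mu \<in> partitions n \<and> lam \<noteq> mu \<and>
     (obtained_from lam mu \<or> obtained_from mu lam)"

definition clique_complex :: "nat \<Rightarrow> nat list set set" where
  "clique_complex n = {S. finite S \<and> S \<noteq> {} \<and> S \<subseteq> partitions n \<and>
     (\<forall>lam \<in> S. \<forall>mu \<in> S. lam \<noteq> mu \<longrightarrow> adjacent n lam mu)}"

definition removable_corner :: "nat list \<Rightarrow> cell \<Rightarrow> bool" where
  "removable_corner lam c \<longleftrightarrow> fst c \<in> {1..length lam} \<and> snd c = row_len lam (fst c) \<and>
     row_len lam (fst c + 1) < row_len lam (fst c)"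

definition addable_corner :: "nat list \<Rightarrow> cell \<Rightarrow> bool" where
  "addable_corner lam a \<longleftrightarrow> a \<notin> ferrers lam \<and>
     (\<exists>m. \<exists>mu \<in> partitions m. ferrers mu = insert a (ferrers lam))"

definition transfer :: "nat list \<Rightarrow> cell \<Rightarrow> cell \<Rightarrow> nat list" where
  "transfer lam c a = move_cell lam (fst c) (fst a)"

definition admissible :: "nat \<Rightarrow> nat list \<Rightarrow> cell \<Rightarrow> cell \<Rightarrow> bool" where
  "admissible n lam c a \<longleftrightarrow> removable_corner lam c \<and> addable_corner lam a \<and> fst c \<noteq> fst a \<and>
     transfer lam c a \<in> partitions n \<and> transfer lam c a \<noteq> lam"

definition star_max :: "nat \<Rightarrow> nat list \<Rightarrow> cell \<Rightarrow> nat list set" where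
  "star_max n lam c = {lam} \<union> {transfer lam c a | a. admissible n lam c a}"

definition top_max :: "nat \<Rightarrow> nat list \<Rightarrow> cell \<Rightarrow> nat list set" where
  "top_max n lam a = {lam} \<union> {transfer lam c a | c. admissible n lam c a}"

definition full_simplices :: "nat \<Rightarrow> nat list set set" where
  "full_simplices n =
     {star_max n lam c | lam c. lam \<in> partitions n \<and> removable_corner lam c} \<union>
     {top_max n lam a | lam a. lam \<in> partitions n \<and> addable_corner lam a}"

definition A_vertex :: "nat \<Rightarrow> nat list \<Rightarrow> nat list set set" where
  "A_vertex n lam = {U \<in> full_simplices n. lam \<in> U}"

definition A_simplex :: "nat \<Rightarrow> nat list set \<Rightarrow> nat list set set" where
  "A_simplex n S = (\<Inter>lam \<in> S. A_vertex n lam)"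

definition J_poset :: "nat \<Rightarrow> nat list set set set" where
  "J_poset n = {A_simplex n S | S. S \<in> clique_complex n}"

text \<open>
  The order complex of a family of sets ordered by inclusion, and the dimension of a
  simplicial complex given by its nonempty simplices (\<open>-\<infinity>\<close> for the complex without simplices).
\<close>

definition order_complex :: "'a set set \<Rightarrow> 'a set set set" where
  "order_complex P = {T. finite T \<and> T \<noteq> {} \<and> subset.chain P T}"

definition complex_dim :: "'a set set \<Rightarrow> ereal" where
  "complex_dim K = (SUP T \<in> K. ereal (real (card T) - 1))"

end

theory Submission
  imports Defs "HOL-Library.Multiset"
begin

text \<open>
  In terms of Ferrers diagrams, adjacent partitions differ by exchanging one cell. Hence a full
  star-simplex consists of all partitions of \<open>n\<close> containing a fixed diagram with \<open>n - 1\<close> cells, and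
  a full top-simplex of all partitions of \<open>n\<close> contained in a fixed diagram with \<open>n + 1\<close> cells.
  An edge \<open>\<lambda>\<mu>\<close> lies only in those given by \<open>\<lambda> \<inter> \<mu>\<close> and \<open>\<lambda> \<union> \<mu>\<close> (which may coincide as sets), and
  every clique lies in at least one full simplex, so \<open>A\<^sub>S\<close> has one or two elements whenever \<open>S\<close> has at least two vertices. The
  sets \<open>A\<^sub>\<lambda>\<close> form an antichain: \<open>\<lambda>\<close> has two addable corners, and a partition of \<open>n\<close> contained in
  both enlargements of \<open>\<lambda>\<close> is \<open>\<lambda>\<close> itself. So all members of a chain except the largest one have
  cardinality 1 or 2.
\<close>

section \<open>Partitions and their Ferrers diagrams as down-closed cell sets\<close>

definition is_partition :: "nat list \<Rightarrow> bool" where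
  "is_partition lam \<longleftrightarrow> sorted_wrt (\<ge>) lam \<and> (\<forall>x \<in> set lam. 0 < x)"

lemma partitions_iff: "lam \<in> partitions n \<longleftrightarrow> is_partition lam \<and> sum_list lam = n"
  by (auto simp: partitions_def is_partition_def)

lemma mem_ferrers: "(i, j) \<in> ferrers lam \<longleftrightarrow> 1 \<le> i \<and> 1 \<le> j \<and> j \<le> row_len lam i"
  by (auto simp: ferrers_def row_len_def)

lemma row_len_antimono:
  assumes "is_partition lam" "1 \<le> i" "i \<le> i'"
  shows "row_len lam i' \<le> row_len lam i"
  using assms unfolding is_partition_def row_len_def sorted_wrt_iff_nth_less
  by (cases "i = i'") auto

text \<open>Finite order ideals of the positive quadrant. In this form closure under union and
  intersection is immediate, which is what later turns exchanged cells into corners.\<close>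

definition diagram :: "cell set \<Rightarrow> bool" where
  "diagram D \<longleftrightarrow> finite D \<and> (\<forall>(i, j) \<in> D. 1 \<le> i \<and> 1 \<le> j \<and>
     (\<forall>i' j'. 1 \<le> i' \<longrightarrow> i' \<le> i \<longrightarrow> 1 \<le> j' \<longrightarrow> j' \<le> j \<longrightarrow> (i', j') \<in> D))"

lemma diagramI:
  assumes "finite D" "\<And>i j. (i, j) \<in> D \<Longrightarrow> 1 \<le> i \<and> 1 \<le> j"
    "\<And>i j i' j'. (i, j) \<in> D \<Longrightarrow> 1 \<le> i' \<Longrightarrow> i' \<le> i \<Longrightarrow> 1 \<le> j' \<Longrightarrow> j' \<le> j \<Longrightarrow> (i', j') \<in> D"
  shows "diagram D"
  using assms unfolding diagram_def by blast

lemma diagramD: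
  assumes "diagram D" "(i, j) \<in> D" "1 \<le> i'" "i' \<le> i" "1 \<le> j'" "j' \<le> j"
  shows "(i', j') \<in> D"
  using assms unfolding diagram_def by blast

lemma diagram_Un: "diagram D \<Longrightarrow> diagram E \<Longrightarrow> diagram (D \<union> E)"
  unfolding diagram_def by blast

lemma diagram_Int: "diagram D \<Longrightarrow> diagram E \<Longrightarrow> diagram (D \<inter> E)"
  unfolding diagram_def by blast

lemma ferrers_eq_Sigma: "ferrers lam = (SIGMA i:{1..length lam}. {1..row_len lam i})"
  by (auto simp: ferrers_def)

lemma finite_ferrers [simp]: "finite (ferrers lam)"
  by (simp add: ferrers_eq_Sigma)

lemma card_ferrers: "card (ferrers lam) = sum_list lam"
proof -
  have "card (ferrers lam) = (\<Sum>i\<in>{1..length lam}. row_len lam i)"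
    by (simp add: ferrers_eq_Sigma)
  also have "\<dots> = (\<Sum>i\<in>{0..<length lam}. lam ! i)"
    by (rule sum.reindex_bij_witness[of _ Suc "\<lambda>i. i - 1"]) (auto simp: row_len_def)
  finally show ?thesis by (simp add: sum_list_sum_nth)
qed

lemma diagram_ferrers:
  assumes "is_partition lam"
  shows "diagram (ferrers lam)"
proof (rule diagramI)
  fix i j i' j'
  assume "(i, j) \<in> ferrers lam" "1 \<le> i'" "i' \<le> i" "1 \<le> j'" "j' \<le> j"
  then show "(i', j') \<in> ferrers lam"
    using row_len_antimono[OF assms, of i' i] by (auto simp: mem_ferrers)
qed (auto simp: mem_ferrers)

lemma row_len_eq_card: "1 \<le> i \<Longrightarrow> row_len lam i = card {j. (i, j) \<in> ferrers lam}"
proof -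
  assume "1 \<le> i"
  then have "{j. (i, j) \<in> ferrers lam} = {1..row_len lam i}"
    by (auto simp: mem_ferrers)
  then show ?thesis by simp
qed

lemma ferrers_column_1:
  assumes "is_partition lam"
  shows "{i. (i, 1) \<in> ferrers lam} = {1..length lam}"
  using assms by (auto simp: ferrers_def row_len_def is_partition_def Suc_leI)

text \<open>The first column determines the number of rows, and the cardinality of each row of cells
  determines its length.\<close>

lemma ferrers_inject:
  assumes "is_partition lam" "is_partition mu" "ferrers lam = ferrers mu"
  shows "lam = mu"
proof -
  have len: "length lam = length mu"
    using ferrers_column_1[OF assms(1)] ferrers_column_1[OF assms(2)] assms(3)
    by (metis card_atLeastAtMost diff_Suc_1)
  show ?thesis
  proof (rule nth_equalityI[OF len])
    fix i assume "i < length lam"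
    then show "lam ! i = mu ! i"
      using row_len_eq_card[of "Suc i" lam] row_len_eq_card[of "Suc i" mu] assms(3) len
      by (auto simp: row_len_def)
  qed
qed

text \<open>Used for the rows and the first column of a diagram, which are thereby determined by
  their cardinalities.\<close>

lemma initial_segment_eq:
  fixes X :: "nat set"
  assumes "finite X" "\<And>x y. x \<in> X \<Longrightarrow> 1 \<le> y \<Longrightarrow> y \<le> x \<Longrightarrow> y \<in> X" "0 \<notin> X"
  shows "X = {1..card X}"
proof (cases "X = {}")
  case False
  have "X = {1..Max X}"
  proof (intro equalityI subsetI)
    fix x assume "x \<in> X"
    moreover have "x \<noteq> 0" using assms(3) \<open>x \<in> X\<close> by metis
    ultimately show "x \<in> {1..Max X}" using assms(1) by simp
  next
    fix x assume "x \<in> {1..Max X}"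
    then show "x \<in> X" using assms(2)[OF Max_in[OF assms(1) False]] by simp
  qed
  then show ?thesis by (metis card_atLeastAtMost diff_Suc_1)
qed simp

text \<open>The partition lists the cardinalities of the rows of \<open>D\<close>; the size
  \<open>L\<close> of the first column is the number of nonempty rows.\<close>

lemma diagram_is_ferrers:
  assumes "diagram D"
  obtains lam where "is_partition lam" "ferrers lam = D"
proof -
  define row where "row i = {j. (i, j) \<in> D}" for i
  define L where "L = card {i. (i, 1) \<in> D}"
  have fin: "finite D" and pos: "\<And>i j. (i, j) \<in> D \<Longrightarrow> 1 \<le> i \<and> 1 \<le> j"
    using assms unfolding diagram_def by blast+
  have row: "row i = {1..card (row i)}" for i
  proof (rule initial_segment_eq)
    have "row i \<subseteq> snd ` D" by (force simp: row_def)
    then show "finite (row i)" using fin finite_subset by blast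
    show "y \<in> row i" if "x \<in> row i" "1 \<le> y" "y \<le> x" for x y
      using diagramD[OF assms, of i x i y] pos[of i x] that by (simp add: row_def)
  qed (use pos in \<open>force simp: row_def\<close>)
  have col: "{i. (i, 1) \<in> D} = {1..L}" unfolding L_def
  proof (rule initial_segment_eq)
    have "{i. (i, 1) \<in> D} \<subseteq> fst ` D" by force
    then show "finite {i. (i, 1) \<in> D}" using fin finite_subset by blast
    show "y \<in> {i. (i, 1) \<in> D}" if "x \<in> {i. (i, 1) \<in> D}" "1 \<le> y" "y \<le> x" for x y
      using diagramD[OF assms, of x 1 y 1] that by simp
  qed (use pos in force)
  define lam where "lam = map (\<lambda>i. card (row (Suc i))) [0..<L]"
  have rl: "row_len lam i = (if 1 \<le> i \<and> i \<le> L then card (row i) else 0)" for i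
    by (auto simp: row_len_def lam_def)
  have mem: "(i, j) \<in> D \<longleftrightarrow> 1 \<le> j \<and> j \<le> card (row i)" for i j
    using row[of i] by (auto simp: row_def)
  have memL: "(i, 1) \<in> D \<longleftrightarrow> 1 \<le> i \<and> i \<le> L" for i
    using col by auto
  have "is_partition lam"
    unfolding is_partition_def sorted_wrt_iff_nth_less
  proof (intro conjI allI impI ballI)
    fix i j assume ij: "i < j" "j < length lam"
    then have nth: "lam ! i = card (row (Suc i))" "lam ! j = card (row (Suc j))"
      by (simp_all add: lam_def)
    show "lam ! j \<le> lam ! i"
    proof (cases "lam ! j = 0")
      case False
      then have "(Suc j, lam ! j) \<in> D" unfolding mem nth by simp
      then have "(Suc i, lam ! j) \<in> D"
        by (rule diagramD[OF assms]) (use ij False in simp_all)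
      then show ?thesis unfolding mem nth by simp
    qed simp
  next
    fix x assume "x \<in> set lam"
    then obtain i where "i < L" "x = card (row (Suc i))" by (auto simp: lam_def)
    then show "0 < x" using memL[of "Suc i"] mem[of "Suc i" 1] by auto
  qed
  moreover have "ferrers lam = D"
  proof -
    have "(i, j) \<in> ferrers lam \<longleftrightarrow> (i, j) \<in> D" for i j
      using mem[of i j] memL[of i] mem[of i 1] pos[of i j] by (auto simp: mem_ferrers rl)
    then show ?thesis by auto
  qed
  ultimately show ?thesis using that by blast
qed

section \<open>Corners as cells whose addition or removal leaves a diagram\<close>

lemma addable_corner_iff:
  "addable_corner lam a \<longleftrightarrow> a \<notin> ferrers lam \<and> diagram (insert a (ferrers lam))"
proof -
  have "(\<exists>m. \<exists>mu\<in>partitions m. ferrers mu = D) \<longleftrightarrow> diagram D" for D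
  proof
    assume "diagram D"
    then obtain mu where "is_partition mu" "ferrers mu = D" by (rule diagram_is_ferrers)
    then have "mu \<in> partitions (sum_list mu)" by (simp add: partitions_iff)
    then show "\<exists>m. \<exists>mu\<in>partitions m. ferrers mu = D" using \<open>ferrers mu = D\<close> by blast
  qed (auto simp: partitions_iff diagram_ferrers)
  then show ?thesis by (simp add: addable_corner_def)
qed

text \<open>Both sides say that \<open>c\<close> is a maximal cell in the componentwise order: no
  other cell of the diagram lies weakly below and to the right of it.\<close>

lemma removable_corner_iff:
  assumes "is_partition lam"
  shows "removable_corner lam c \<longleftrightarrow> c \<in> ferrers lam \<and> diagram (ferrers lam - {c})"
proof (cases c)
  case (Pair i p)
  note D = diagram_ferrers[OF assms]
  show ?thesis
  proof
    assume "removable_corner lam c"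
    then have c: "1 \<le> i" "p = row_len lam i" "row_len lam (i + 1) < p"
      by (auto simp: removable_corner_def Pair)
    have "i' = i \<and> j' = p" if "(i', j') \<in> ferrers lam" "i \<le> i'" "p \<le> j'" for i' j'
      using that c row_len_antimono[OF assms, of i i'] row_len_antimono[OF assms, of "i+1" i']
      by (cases "i = i'") (auto simp: mem_ferrers)
    then have "diagram (ferrers lam - {c})"
      using diagramD[OF D] by (intro diagramI) (auto simp: Pair mem_ferrers)
    moreover have "c \<in> ferrers lam" using c by (auto simp: Pair mem_ferrers)
    ultimately show "c \<in> ferrers lam \<and> diagram (ferrers lam - {c})" by blast
  next
    assume R: "c \<in> ferrers lam \<and> diagram (ferrers lam - {c})"
    then have ip: "1 \<le> i" "1 \<le> p" "p \<le> row_len lam i" by (auto simp: Pair mem_ferrers)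
    have no: "(i', j') \<notin> ferrers lam" if "i \<le> i'" "p \<le> j'" "(i', j') \<noteq> c" for i' j'
      using diagramD[of "ferrers lam - {c}" i' j' i p] R that ip by (auto simp: Pair)
    have "\<not> p < row_len lam i"
      using no[of i "Suc p"] ip by (auto simp: Pair mem_ferrers)
    moreover have "row_len lam (i + 1) < p"
      using no[of "Suc i" p] ip by (auto simp: Pair mem_ferrers)
    moreover have "i \<le> length lam"
      using ip by (auto simp: row_len_def split: if_splits)
    ultimately show "removable_corner lam c"
      using ip by (auto simp: removable_corner_def Pair)
  qed
qed

section \<open>Column lengths and the effect of moving a cell\<close>

text \<open>For \<open>k \<ge> 1\<close> this is the \<open>k\<close>-th part of the conjugate
  partition. It does not depend on the order of the rows, so the sorting in \<open>move_cell\<close>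
  leaves it unchanged.\<close>

definition col_len :: "nat list \<Rightarrow> nat \<Rightarrow> nat" where
  "col_len lam k = length (filter ((\<le>) k) lam)"

text \<open>In a weakly decreasing list the entries that are at least \<open>k\<close> form a
  prefix.\<close>

lemma mem_ferrers_col:
  assumes "is_partition lam"
  shows "(i, k) \<in> ferrers lam \<longleftrightarrow> 1 \<le> k \<and> 1 \<le> i \<and> i \<le> col_len lam k"
proof -
  have *: "(i < length lam \<and> k \<le> lam ! i) = (i < length (filter ((\<le>) k) lam))"
    if "sorted_wrt (\<ge>) lam" for i and lam :: "nat list"
    using that
  proof (induction lam arbitrary: i)
    case (Cons x lam)
    show ?case
    proof (cases "k \<le> x")
      case True
      then show ?thesis using Cons by (cases i) auto
    next
      case False
      then have "filter ((\<le>) k) lam = []" using Cons.prems by (auto simp: filter_empty_conv)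
      then show ?thesis using False Cons.prems by (cases i) (auto simp: filter_empty_conv)
    qed
  qed simp
  show ?thesis
    using *[of lam "i - 1"] assms
    by (cases i) (auto simp: mem_ferrers row_len_def col_len_def is_partition_def)
qed

lemma is_partition_move_cell: "is_partition (move_cell lam i j)"
  unfolding is_partition_def move_cell_def by (auto simp: sorted_wrt_rev)

text \<open>The index range includes the empty row \<open>length lam + 1\<close>, to match
  \<open>move_cell\<close>; since \<open>k \<ge> 1\<close>, that row contributes nothing.\<close>

lemma col_len_eq_card:
  assumes "1 \<le> k"
  shows "col_len lam k = card {r \<in> {1..length lam + 1}. k \<le> row_len lam r}"
proof -
  have "col_len lam k = card {r. r < length lam \<and> k \<le> lam ! r}"
    by (simp add: col_len_def length_filter_conv_card)
  also have "\<dots> = card {r \<in> {1..length lam + 1}. k \<le> row_len lam r}"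
    using assms by (intro bij_betw_same_card[of Suc] bij_betw_byWitness[where f'="\<lambda>r. r - 1"])
      (auto simp: row_len_def split: if_splits)
  finally show ?thesis .
qed

text \<open>Row \<open>i\<close> loses its cell in column \<open>row_len lam i\<close>, and row
  \<open>j\<close> gains one in column \<open>row_len lam j + 1\<close>. The additive form avoids
  truncated subtraction and also covers the case that both columns agree.\<close>

lemma col_len_move_cell:
  assumes "i \<in> {1..length lam}" "j \<in> {1..length lam + 1}" "i \<noteq> j" "1 \<le> k" "is_partition lam"
  shows "col_len (move_cell lam i j) k + of_bool (k = row_len lam i)
    = col_len lam k + of_bool (k = row_len lam j + 1)"
proof -
  define f where "f r = (if r = i then row_len lam r - 1
    else if r = j then row_len lam r + 1 else row_len lam r)" for r
  define X where "X = {r \<in> {1..length lam + 1}. k \<le> f r}"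
  define Y where "Y = {r \<in> {1..length lam + 1}. k \<le> row_len lam r}"
  have "col_len (move_cell lam i j) k
      = size (filter_mset ((\<le>) k) (mset (move_cell lam i j)))"
    by (simp add: col_len_def flip: mset_filter)
  \<comment> \<open>Sorting and reversing keep the multiset, and the discarded zeros are never
    counted because \<open>k \<ge> 1\<close>.\<close>
  also have "\<dots> = size (filter_mset ((\<le>) k) (mset (map f [1..<length lam + 2])))"
    using assms(4) unfolding move_cell_def f_def
    by (simp add: filter_filter_mset del: upt_Suc mset_map map_upt_Suc)
       (rule arg_cong[where f=size], rule filter_mset_cong, auto)
  also have "\<dots> = length (filter (\<lambda>r. k \<le> f r) [1..<length lam + 2])"
    by (simp add: filter_map o_def flip: mset_filter del: upt_Suc mset_map mset_upt)
  also have "\<dots> = card X"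
    by (subst distinct_card[symmetric])
       (auto simp: X_def simp del: upt_Suc intro!: arg_cong[where f=card])
  finally have mv: "col_len (move_cell lam i j) k = card X" .
  \<comment> \<open>This makes the subtraction in \<open>f i\<close> exact.\<close>
  have p: "0 < row_len lam i" using assms by (auto simp: row_len_def is_partition_def)
  have fin: "finite X" "finite Y" by (auto simp: X_def Y_def)
  have i: "i \<in> X \<longleftrightarrow> k < row_len lam i" "i \<in> Y \<longleftrightarrow> k \<le> row_len lam i"
    using assms p by (auto simp: X_def Y_def f_def)
  have j: "j \<in> X \<longleftrightarrow> k \<le> row_len lam j + 1" "j \<in> Y \<longleftrightarrow> k \<le> row_len lam j"
    using assms p by (auto simp: X_def Y_def f_def)
  \<comment> \<open>Only rows \<open>i\<close> and \<open>j\<close> change, so the two counts differ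
    only through the membership of \<open>i\<close> and \<open>j\<close>.\<close>
  have XY: "X - {i, j} = Y - {i, j}"
    by (auto simp: X_def Y_def f_def)
  have split: "card Z = card (Z - {i, j}) + of_bool (i \<in> Z) + of_bool (j \<in> Z)"
    if "finite Z" for Z
  proof -
    have "card Z = card (Z - {i, j}) + card (Z \<inter> {i, j})"
      using that by (metis card_Int_Diff add.commute)
    moreover have "Z \<inter> {i, j} = (if i \<in> Z then {i} else {}) \<union> (if j \<in> Z then {j} else {})"
      by auto
    ultimately show ?thesis using assms(3) by auto
  qed
  have "card X + of_bool (k = row_len lam i) = card Y + of_bool (k = row_len lam j + 1)"
    using split[OF fin(1)] split[OF fin(2)] unfolding i j XY by auto
  then show ?thesis unfolding mv col_len_eq_card[OF assms(4), of lam] Y_def .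
qed

text \<open>After reordering, column \<open>p\<close> has lost its bottom cell and column
  \<open>q\<close> has gained a cell below its bottom one. For \<open>p = q\<close> the two row
  lengths are merely interchanged.\<close>

lemma ferrers_move_cell:
  assumes "i \<in> {1..length lam}" "j \<in> {1..length lam + 1}" "i \<noteq> j" "is_partition lam"
  defines "p \<equiv> row_len lam i" and "q \<equiv> row_len lam j + 1"
  shows "ferrers (move_cell lam i j) = (if p = q then ferrers lam
    else insert (col_len lam q + 1, q) (ferrers lam - {(col_len lam p, p)}))"
proof -
  have p: "1 \<le> p" using assms by (auto simp: row_len_def is_partition_def Suc_leI)
  have cp: "1 \<le> col_len lam p"
    using mem_ferrers_col[OF assms(4), of i p] mem_ferrers[of i p lam] p assms by auto
  have "(r, k) \<in> ferrers (move_cell lam i j) \<longleftrightarrow> (r, k) \<in> (if p = q then ferrers lam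
    else insert (col_len lam q + 1, q) (ferrers lam - {(col_len lam p, p)}))" for r k
  proof (cases "1 \<le> k")
    case True
    note c = col_len_move_cell[OF assms(1-3) True assms(4), folded p_def q_def]
    have "1 \<le> q" by (simp add: q_def)
    moreover have "k = p \<or> k = q \<or> k \<noteq> p \<and> k \<noteq> q" by blast
    ultimately show ?thesis
      using c True p cp
      by (elim disjE) (auto simp: mem_ferrers_col[OF is_partition_move_cell] mem_ferrers_col[OF assms(4)])
  qed (auto simp: mem_ferrers q_def)
  then show ?thesis by auto
qed

text \<open>For corners, \<open>c\<close> is the bottom cell of its column and \<open>a\<close> lies
  directly below the bottom of its column, so these are the cells named in
  \<open>ferrers_move_cell\<close>.\<close>

lemma ferrers_transfer:
  assumes "is_partition lam" "removable_corner lam c" "addable_corner lam a" "fst c \<noteq> fst a"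
  shows "ferrers (transfer lam c a) = (if snd c = snd a then ferrers lam
    else insert a (ferrers lam - {c}))"
proof -
  obtain i p j q where ca: "c = (i, p)" "a = (j, q)" by fastforce
  have c: "i \<in> {1..length lam}" "p = row_len lam i" "row_len lam (i + 1) < p"
    using assms(2) by (auto simp: removable_corner_def ca)
  have "(i, p) \<in> ferrers lam" "(i + 1, p) \<notin> ferrers lam"
    using c by (auto simp: mem_ferrers)
  then have cp: "col_len lam p = i"
    by (auto simp: mem_ferrers_col[OF assms(1)])
  have a: "(j, q) \<notin> ferrers lam" "diagram (insert (j, q) (ferrers lam))"
    using assms(3) by (auto simp: addable_corner_iff ca)
  then have jq: "1 \<le> j" "1 \<le> q" unfolding diagram_def by auto
  \<comment> \<open>Applied to the neighbors of \<open>a\<close> above and to the left, this gives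
    \<open>j\<close> and \<open>q\<close>; applied to \<open>(j - 1, 1)\<close>, it bounds
    \<open>j\<close> by \<open>length lam + 1\<close>.\<close>
  have up: "(j', q') \<in> ferrers lam"
    if "1 \<le> j'" "j' \<le> j" "1 \<le> q'" "q' \<le> q" "(j', q') \<noteq> (j, q)" for j' q'
    using diagramD[OF a(2), of j q j' q'] that by auto
  have "col_len lam q + 1 = j"
    using up[of "j - 1" q] a(1) jq
    by (cases "j = 1") (simp_all add: mem_ferrers_col[OF assms(1)], linarith)
  moreover have q: "q = row_len lam j + 1"
    using up[of j "q - 1"] a(1) jq by (cases "q = 1") (simp_all add: mem_ferrers, linarith)
  moreover have "j \<in> {1..length lam + 1}"
  proof (cases "j = 1")
    case False
    then have "(j - 1, 1) \<in> ferrers lam" using up[of "j - 1" 1] jq by force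
    then show ?thesis using jq by (auto simp: ferrers_def)
  qed simp
  ultimately show ?thesis
    using ferrers_move_cell[OF c(1), of j] assms c cp by (auto simp: transfer_def ca)
qed

text \<open>The union and the intersection of the two diagrams are again diagrams, so
  \<open>a\<close> is addable and \<open>c\<close> is removable.\<close>

lemma admissible_exchange:
  assumes "lam \<in> partitions n" "mu \<in> partitions n" "c \<in> ferrers lam" "a \<notin> ferrers lam"
    "ferrers mu = insert a (ferrers lam - {c})"
  shows "admissible n lam c a" "transfer lam c a = mu"
proof -
  have P: "is_partition lam" "is_partition mu" using assms by (auto simp: partitions_iff)
  note D = diagram_ferrers[OF P(1)] diagram_ferrers[OF P(2)]
  have "ferrers lam \<union> ferrers mu = insert a (ferrers lam)"
    "ferrers lam \<inter> ferrers mu = ferrers lam - {c}" using assms by auto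
  then have rem: "removable_corner lam c" and add: "addable_corner lam a"
    using assms(3,4) diagram_Un[OF D] diagram_Int[OF D] P
    by (simp_all add: removable_corner_iff addable_corner_iff)
  obtain i p j q where ca: "c = (i, p)" "a = (j, q)" by fastforce
  have "(i, p) \<in> ferrers lam" "(j, q) \<notin> ferrers lam" "(j, q) \<in> ferrers mu" "(i, p) \<notin> ferrers mu"
    using assms by (auto simp: ca)
  \<comment> \<open>In a common row or column \<open>c\<close> and \<open>a\<close> would be
    comparable, and down-closure would put \<open>a\<close> into \<open>lam\<close> or
    \<open>c\<close> into \<open>mu\<close>.\<close>
  then have ne: "i \<noteq> j" "p \<noteq> q"
    using diagramD[OF D(1), of i p j q] diagramD[OF D(2), of j q i p] nat_le_linear[of i j]
    by (auto simp: mem_ferrers)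
  then have F: "ferrers (transfer lam c a) = ferrers mu"
    using ferrers_transfer[OF P(1) rem add] assms by (auto simp: ca)
  show eq: "transfer lam c a = mu"
    by (rule ferrers_inject[OF _ P(2) F]) (simp add: transfer_def is_partition_move_cell)
  show "admissible n lam c a"
    using rem add ne assms unfolding admissible_def eq by (auto simp: ca)
qed

text \<open>Admissibility demands a result different from \<open>lam\<close>, which rules out a
  transfer within one column.\<close>

lemma ferrers_transfer_admissible:
  assumes "lam \<in> partitions n" "admissible n lam c a"
  shows "ferrers (transfer lam c a) = insert a (ferrers lam - {c})"
proof -
  have *: "is_partition lam" "is_partition (transfer lam c a)"
    using assms by (auto simp: admissible_def partitions_iff)
  then show ?thesis
    using ferrers_transfer[OF *(1), of c a] ferrers_inject[OF *(2,1)] assms(2)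
    by (auto simp: admissible_def split: if_splits)
qed

section \<open>Full simplices described by inclusion of cell sets\<close>

lemma card_ferrers_partitions: "lam \<in> partitions n \<Longrightarrow> card (ferrers lam) = n"
  by (simp add: partitions_iff card_ferrers)

lemma partitions_eqI:
  assumes "lam \<in> partitions n" "mu \<in> partitions n" "ferrers lam \<subseteq> ferrers mu"
  shows "lam = mu"
  using assms ferrers_inject card_subset_eq[of "ferrers mu" "ferrers lam"]
  by (auto simp: partitions_iff card_ferrers)

text \<open>Singles out neither a base partition nor a corner, so that incidence of a vertex with a
  full star-simplex becomes an inclusion; \<open>down_simplex\<close> does the same for
  top-simplices.\<close>

definition up_simplex :: "nat \<Rightarrow> cell set \<Rightarrow> nat list set" where
  "up_simplex n D = {mu \<in> partitions n. D \<subseteq> ferrers mu}"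

definition down_simplex :: "nat \<Rightarrow> cell set \<Rightarrow> nat list set" where
  "down_simplex n D = {mu \<in> partitions n. ferrers mu \<subseteq> D}"

text \<open>A partition of \<open>n\<close> containing the \<open>n - 1\<close> cells has exactly
  one further cell \<open>a\<close>. If it differs from \<open>lam\<close>, then \<open>a\<close>
  lies outside \<open>lam\<close>, and \<open>admissible_exchange\<close> provides the
  transfer.\<close>

lemma star_max_eq_up_simplex:
  assumes "lam \<in> partitions n" "removable_corner lam c"
  shows "star_max n lam c = up_simplex n (ferrers lam - {c})"
proof (intro equalityI subsetI)
  fix mu assume "mu \<in> star_max n lam c"
  then show "mu \<in> up_simplex n (ferrers lam - {c})"
    using assms(1) by (auto simp: star_max_def up_simplex_def ferrers_transfer_admissible)
      (simp add: admissible_def)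
next
  fix mu assume "mu \<in> up_simplex n (ferrers lam - {c})"
  then have mu: "mu \<in> partitions n" "ferrers lam - {c} \<subseteq> ferrers mu"
    by (auto simp: up_simplex_def)
  have c: "c \<in> ferrers lam"
    using assms removable_corner_iff by (auto simp: partitions_iff)
  \<comment> \<open>Ensures that the truncated difference \<open>n - (n - 1)\<close> is 1.\<close>
  then have n: "0 < n" using card_ferrers_partitions[OF assms(1)]
    by (metis card_gt_0_iff empty_iff finite_ferrers)
  show "mu \<in> star_max n lam c"
  proof (cases "mu = lam")
    case False
    have "card (ferrers mu - (ferrers lam - {c})) = 1"
      using mu c n card_ferrers_partitions[OF assms(1)] card_ferrers_partitions[OF mu(1)]
      by (simp add: card_Diff_subset)
    then obtain a where a: "ferrers mu - (ferrers lam - {c}) = {a}"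
      by (auto simp: card_1_singleton_iff)
    then have F: "ferrers mu = insert a (ferrers lam - {c})" using mu by blast
    have "a \<notin> ferrers lam"
    proof
      assume "a \<in> ferrers lam"
      then have "ferrers mu \<subseteq> ferrers lam" using F by auto
      then show False using partitions_eqI[OF mu(1) assms(1)] False by simp
    qed
    then show ?thesis
      using admissible_exchange[OF assms(1) mu(1) c _ F] unfolding star_max_def by blast
  qed (auto simp: star_max_def)
qed

text \<open>Dually, \<open>mu\<close> misses exactly one cell \<open>c\<close> of the enlarged
  diagram. If \<open>mu\<close> differs from \<open>lam\<close>, it contains \<open>a\<close>, since
  otherwise its diagram would lie inside that of \<open>lam\<close>.\<close>

lemma top_max_eq_down_simplex:
  assumes "lam \<in> partitions n" "addable_corner lam a"
  shows "top_max n lam a = down_simplex n (insert a (ferrers lam))"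
proof (intro equalityI subsetI)
  fix mu assume "mu \<in> top_max n lam a"
  then show "mu \<in> down_simplex n (insert a (ferrers lam))"
    using assms(1) by (auto simp: top_max_def down_simplex_def ferrers_transfer_admissible)
      (simp add: admissible_def)
next
  fix mu assume "mu \<in> down_simplex n (insert a (ferrers lam))"
  then have mu: "mu \<in> partitions n" "ferrers mu \<subseteq> insert a (ferrers lam)"
    by (auto simp: down_simplex_def)
  have a: "a \<notin> ferrers lam"
    using assms by (auto simp: addable_corner_iff)
  show "mu \<in> top_max n lam a"
  proof (cases "mu = lam")
    case False
    have "card (insert a (ferrers lam) - ferrers mu) = 1"
      using mu a card_ferrers_partitions[OF assms(1)] card_ferrers_partitions[OF mu(1)]
      by (simp add: card_Diff_subset)
    then obtain c where c: "insert a (ferrers lam) - ferrers mu = {c}"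
      by (auto simp: card_1_singleton_iff)
    have "a \<in> ferrers mu"
      using partitions_eqI[OF mu(1) assms(1)] False mu by blast
    then have "c \<in> ferrers lam" using c by auto
    moreover have "ferrers mu = insert a (ferrers lam) - {c}" using c mu by (metis Diff_Diff_Int inf.absorb2)
    ultimately have "ferrers mu = insert a (ferrers lam - {c})" "c \<in> ferrers lam"
      using a by auto
    then show ?thesis
      using admissible_exchange[OF assms(1) mu(1) _ a] unfolding top_max_def by blast
  qed (auto simp: top_max_def)
qed

section \<open>Cliques under exchange of one element, and adjacency as exchange\<close>

text \<open>On finite sets of a fixed size this is adjacency in a Johnson graph.\<close>

definition exchange :: "'a set \<Rightarrow> 'a set \<Rightarrow> bool" where
  "exchange A B \<longleftrightarrow> (\<exists>x y. A - B = {x} \<and> B - A = {y})"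

lemma exchange_sym: "exchange A B \<Longrightarrow> exchange B A"
  unfolding exchange_def by blast

text \<open>If \<open>C\<close> misses some \<open>z\<close> of \<open>A \<inter> B\<close> and has
  some \<open>y\<close> outside \<open>A \<union> B\<close>, then \<open>y\<close> is all of
  \<open>C - A\<close>. Hence the element \<open>w\<close> of \<open>B - A\<close> is not in
  \<open>C\<close>, and \<open>B - C\<close> contains both \<open>w\<close> and
  \<open>z\<close>.\<close>

lemma exchange_triangle:
  assumes "exchange A B" "exchange A C" "exchange B C"
  shows "A \<inter> B \<subseteq> C \<or> C \<subseteq> A \<union> B"
proof (rule ccontr)
  assume "\<not> ?thesis"
  then obtain z y where z: "z \<in> A" "z \<in> B" "z \<notin> C" and y: "y \<in> C" "y \<notin> A" "y \<notin> B" by blast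
  obtain w where w: "w \<in> B" "w \<notin> A" using assms(1) unfolding exchange_def by blast
  obtain y' where "C - A = {y'}" using assms(2) unfolding exchange_def by auto
  then have "C - A = {y}" using y(1,2) by (metis DiffI singletonD)
  then have "w \<notin> C" using w y(3) by (metis DiffI singletonD)
  then have "w \<in> B - C" "z \<in> B - C" using w z by simp_all
  moreover have "w \<noteq> z" using w(2) z(1) by metis
  ultimately show False using assms(3) unfolding exchange_def by (metis singletonD)
qed

text \<open>By the triangle lemma each member satisfies one alternative; the point is that one
  alternative serves all. Otherwise some \<open>C\<close> misses a point \<open>z\<close> of
  \<open>A \<inter> B\<close> and lies in \<open>A \<union> B\<close>, while some \<open>D\<close>
  contains \<open>A \<inter> B\<close> and has a point \<open>y\<close> outside
  \<open>A \<union> B\<close>, so \<open>D - C\<close> has two elements.\<close>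

lemma exchange_clique:
  assumes S: "\<And>A B. A \<in> S \<Longrightarrow> B \<in> S \<Longrightarrow> A \<noteq> B \<Longrightarrow> exchange A B" and "A \<in> S" "B \<in> S" "A \<noteq> B"
  shows "(\<forall>C\<in>S. A \<inter> B \<subseteq> C) \<or> (\<forall>C\<in>S. C \<subseteq> A \<union> B)"
proof (rule ccontr)
  have *: "A \<inter> B \<subseteq> C \<or> C \<subseteq> A \<union> B" if "C \<in> S" for C
    using exchange_triangle[of A B C] S assms(2-) that by blast
  assume "\<not> ?thesis"
  then obtain C D where CD: "C \<in> S" "D \<in> S" "\<not> A \<inter> B \<subseteq> C" "\<not> D \<subseteq> A \<union> B" by blast
  then have "C \<subseteq> A \<union> B" "A \<inter> B \<subseteq> D" using * by blast+
  moreover have "C \<noteq> D" using CD * by blast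
  then have "exchange D C" using S CD by blast
  moreover obtain y z where "y \<in> D" "y \<notin> A \<union> B" "z \<in> A \<inter> B" "z \<notin> C" using CD(3,4) by blast
  ultimately have "exchange D C" "y \<in> D - C" "z \<in> D - C" "y \<noteq> z" by blast+
  then show False unfolding exchange_def by (metis singletonD)
qed

text \<open>Since \<open>lam \<noteq> mu\<close>, the columns \<open>p\<close> and \<open>q\<close>
  differ, so one cell of \<open>lam\<close> is removed and one cell outside \<open>lam\<close> is
  added.\<close>

lemma obtained_from_exchange:
  assumes "is_partition lam" "is_partition mu" "lam \<noteq> mu" "obtained_from lam mu"
  shows "exchange (ferrers lam) (ferrers mu)"
proof -
  obtain i j where ij: "i \<in> {1..length lam}" "j \<in> {1..length lam + 1}" "i \<noteq> j"
    and mu: "mu = move_cell lam i j"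
    using assms(4) unfolding obtained_from_def by blast
  define p q where "p = row_len lam i" and "q = row_len lam j + 1"
  have "ferrers lam \<noteq> ferrers mu" using ferrers_inject assms by blast
  then have ne: "p \<noteq> q" and F: "ferrers mu = insert (col_len lam q + 1, q) (ferrers lam - {(col_len lam p, p)})"
    using ferrers_move_cell[OF ij assms(1)] unfolding mu p_def q_def by (auto split: if_splits)
  have "(i, p) \<in> ferrers lam"
    using ij assms(1) by (auto simp: mem_ferrers p_def row_len_def is_partition_def Suc_leI)
  then have "(col_len lam p, p) \<in> ferrers lam"
    by (auto simp: mem_ferrers_col[OF assms(1)])
  moreover have "(col_len lam q + 1, q) \<notin> ferrers lam"
    by (auto simp: mem_ferrers_col[OF assms(1)])
  ultimately have "ferrers lam - ferrers mu = {(col_len lam p, p)}"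
    "ferrers mu - ferrers lam = {(col_len lam q + 1, q)}"
    using F ne by auto
  then show ?thesis unfolding exchange_def by blast
qed

lemma adjacent_exchange:
  assumes "adjacent n lam mu"
  shows "exchange (ferrers lam) (ferrers mu)"
  using assms obtained_from_exchange[of lam mu] obtained_from_exchange[of mu lam] exchange_sym
  by (auto simp: adjacent_def partitions_iff)

section \<open>The sets of full simplices through a clique or a vertex\<close>

lemma star_max_in_full_simplices:
  "lam \<in> partitions n \<Longrightarrow> removable_corner lam c \<Longrightarrow> star_max n lam c \<in> full_simplices n"
  unfolding full_simplices_def by blast

lemma top_max_in_full_simplices:
  "lam \<in> partitions n \<Longrightarrow> addable_corner lam a \<Longrightarrow> top_max n lam a \<in> full_simplices n"
  unfolding full_simplices_def by blast

text \<open>Keeps only the cardinality of the defining cell set, which is enough to identify it from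
  an inclusion.\<close>

lemma full_simplices_cases:
  assumes "U \<in> full_simplices n"
  obtains (up) D where "U = up_simplex n D" "finite D" "card D + 1 = n"
  | (down) D where "U = down_simplex n D" "finite D" "card D = n + 1"
proof -
  from assms consider lam c where "lam \<in> partitions n" "removable_corner lam c" "U = star_max n lam c"
    | lam a where "lam \<in> partitions n" "addable_corner lam a" "U = top_max n lam a"
    unfolding full_simplices_def by blast
  then show ?thesis
  proof cases
    case 1
    then have c: "c \<in> ferrers lam" by (auto simp: removable_corner_iff partitions_iff)
    have "card (ferrers lam - {c}) + 1 = n"
      using card.remove[OF finite_ferrers c] card_ferrers_partitions[OF 1(1)] by simp
    then show ?thesis using 1 up star_max_eq_up_simplex by auto
  next
    case 2
    then have "card (insert a (ferrers lam)) = n + 1"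
      using card_ferrers_partitions[OF 2(1)] by (auto simp: addable_corner_iff)
    then show ?thesis using 2 down top_max_eq_down_simplex by auto
  qed
qed

text \<open>A defining set of \<open>n - 1\<close> cells lies in the intersection of the two
  diagrams, which has the same size; a defining set of \<open>n + 1\<close> cells contains their
  union, again of the same size.\<close>

lemma A_simplex_edge_subset:
  assumes "lam \<in> S" "mu \<in> S" "adjacent n lam mu"
  shows "A_simplex n S \<subseteq>
    {up_simplex n (ferrers lam \<inter> ferrers mu), down_simplex n (ferrers lam \<union> ferrers mu)}"
proof
  fix U assume "U \<in> A_simplex n S"
  then have U: "U \<in> full_simplices n" "lam \<in> U" "mu \<in> U"
    using assms by (auto simp: A_simplex_def A_vertex_def)
  have P: "lam \<in> partitions n" "mu \<in> partitions n" using assms by (auto simp: adjacent_def)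
  obtain x y where xy: "ferrers lam - ferrers mu = {x}" "ferrers mu - ferrers lam = {y}"
    using adjacent_exchange[OF assms(3)] unfolding exchange_def by blast
  have I: "ferrers lam = insert x (ferrers lam \<inter> ferrers mu)" "x \<notin> ferrers lam \<inter> ferrers mu"
    and Un: "ferrers lam \<union> ferrers mu = insert y (ferrers lam)" "y \<notin> ferrers lam" using xy by auto
  have cI: "card (ferrers lam \<inter> ferrers mu) + 1 = n"
    using card_ferrers_partitions[OF P(1)] card_insert_disjoint[OF _ I(2)] I(1) by simp
  have cU: "card (ferrers lam \<union> ferrers mu) = n + 1"
    using card_ferrers_partitions[OF P(1)] card_insert_disjoint[OF _ Un(2)] Un(1) by simp
  from U(1) show "U \<in> {up_simplex n (ferrers lam \<inter> ferrers mu), down_simplex n (ferrers lam \<union> ferrers mu)}"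
  proof (cases rule: full_simplices_cases)
    case (up D)
    then have "D \<subseteq> ferrers lam \<inter> ferrers mu" using U by (auto simp: up_simplex_def)
    then have "D = ferrers lam \<inter> ferrers mu" using cI up by (intro card_subset_eq) auto
    then show ?thesis using up by simp
  next
    case (down D)
    then have "ferrers lam \<union> ferrers mu \<subseteq> D" using U by (auto simp: down_simplex_def)
    then have "ferrers lam \<union> ferrers mu = D" using cU down by (intro card_subset_eq) auto
    then show ?thesis using down by simp
  qed
qed

text \<open>Apply \<open>exchange_clique\<close> to the diagrams of \<open>S\<close>. The first
  alternative puts \<open>S\<close> into the star-simplex of \<open>lam\<close> at the cell
  \<open>c\<close> lost on the way to \<open>mu\<close>, the second into the top-simplex at the cell
  \<open>a\<close> gained.\<close>

lemma A_simplex_nonempty: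
  assumes "S \<in> clique_complex n" "lam \<in> S" "mu \<in> S" "lam \<noteq> mu"
  shows "A_simplex n S \<noteq> {}"
proof -
  have S: "S \<subseteq> partitions n" and adj: "\<And>A B. A \<in> S \<Longrightarrow> B \<in> S \<Longrightarrow> A \<noteq> B \<Longrightarrow> adjacent n A B"
    using assms by (auto simp: clique_complex_def)
  have P: "lam \<in> partitions n" "mu \<in> partitions n" using assms S by auto
  note D = diagram_ferrers[of lam] diagram_ferrers[of mu]
  have ex: "exchange (ferrers lam) (ferrers mu)" using adj assms adjacent_exchange by blast
  then obtain c a where ca: "ferrers lam - ferrers mu = {c}" "ferrers mu - ferrers lam = {a}"
    unfolding exchange_def by blast
  then have c: "c \<in> ferrers lam" "ferrers lam \<inter> ferrers mu = ferrers lam - {c}"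
    and a: "a \<notin> ferrers lam" "ferrers lam \<union> ferrers mu = insert a (ferrers lam)"
    and mu: "ferrers mu = insert a (ferrers lam - {c})" by auto
  have adm: "removable_corner lam c" "addable_corner lam a"
    using admissible_exchange(1)[OF P c(1) a(1) mu] by (auto simp: admissible_def)
  have "(\<forall>C\<in>ferrers ` S. ferrers lam \<inter> ferrers mu \<subseteq> C) \<or> (\<forall>C\<in>ferrers ` S. C \<subseteq> ferrers lam \<union> ferrers mu)"
  proof (rule exchange_clique)
    fix A B assume "A \<in> ferrers ` S" "B \<in> ferrers ` S" "A \<noteq> B"
    then show "exchange A B" using adj adjacent_exchange by blast
  qed (use assms ca in auto)
  then have "star_max n lam c \<in> A_simplex n S \<or> top_max n lam a \<in> A_simplex n S"
  proof
    assume "\<forall>C\<in>ferrers ` S. ferrers lam \<inter> ferrers mu \<subseteq> C"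
    then have "S \<subseteq> star_max n lam c"
      using S by (auto simp: star_max_eq_up_simplex[OF P(1) adm(1)] up_simplex_def c)
    then show ?thesis
      using star_max_in_full_simplices[OF P(1) adm(1)]
      unfolding A_simplex_def A_vertex_def by blast
  next
    assume "\<forall>C\<in>ferrers ` S. C \<subseteq> ferrers lam \<union> ferrers mu"
    then have "S \<subseteq> top_max n lam a"
      using S by (auto simp: top_max_eq_down_simplex[OF P(1) adm(2)] down_simplex_def a)
    then show ?thesis
      using top_max_in_full_simplices[OF P(1) adm(2)]
      unfolding A_simplex_def A_vertex_def by blast
  qed
  then show ?thesis by blast
qed

text \<open>By hypothesis \<open>mu\<close> lies in every top-simplex based at \<open>lam\<close>.
  Two of them suffice: those that extend the first row and open a new row.\<close>

lemma A_vertex_antichain: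
  assumes "1 \<le> n" "lam \<in> partitions n" "mu \<in> partitions n" "A_vertex n lam \<subseteq> A_vertex n mu"
  shows "lam = mu"
proof -
  have P: "is_partition lam" and ne: "lam \<noteq> []"
    using assms by (auto simp: partitions_iff)
  have sub: "ferrers mu \<subseteq> insert a (ferrers lam)" if "addable_corner lam a" for a
  proof -
    have "top_max n lam a \<in> A_vertex n lam"
      using top_max_in_full_simplices[OF assms(2) that] by (simp add: A_vertex_def top_max_def)
    then have "mu \<in> top_max n lam a" using assms(4) by (auto simp: A_vertex_def)
    then show ?thesis
      using top_max_eq_down_simplex[OF assms(2) that] by (auto simp: down_simplex_def)
  qed
  note D = diagramD[OF diagram_ferrers[OF P]]
  have "diagram (insert (1, row_len lam 1 + 1) (ferrers lam))"
  proof (rule diagramI)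
    fix i j i' j'
    assume ij: "(i, j) \<in> insert (1, row_len lam 1 + 1) (ferrers lam)"
      "1 \<le> i'" "i' \<le> i" "1 \<le> j'" "j' \<le> j"
    show "(i', j') \<in> insert (1, row_len lam 1 + 1) (ferrers lam)"
    proof (cases "(i, j) \<in> ferrers lam")
      case True
      then show ?thesis using D[OF True] ij by simp
    next
      case False
      then have "i' = 1" "j' \<le> row_len lam 1 + 1" using ij by simp_all
      then show ?thesis using ij(4) by (simp add: mem_ferrers le_Suc_eq disj_commute)
    qed
  qed (auto simp: mem_ferrers)
  then have row1: "addable_corner lam (1, row_len lam 1 + 1)"
    by (simp add: addable_corner_iff mem_ferrers)
  have "diagram (insert (length lam + 1, 1) (ferrers lam))"
  proof (rule diagramI)
    fix i j i' j'
    assume ij: "(i, j) \<in> insert (length lam + 1, 1) (ferrers lam)"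
      "1 \<le> i'" "i' \<le> i" "1 \<le> j'" "j' \<le> j"
    have "i' \<in> {i. (i, 1) \<in> ferrers lam}" if "i' \<le> length lam"
      unfolding ferrers_column_1[OF P] using that ij(2) by simp
    moreover have "(i', j') \<in> ferrers lam" if "(i, j) \<in> ferrers lam"
      using D[OF that] ij by simp
    ultimately show "(i', j') \<in> insert (length lam + 1, 1) (ferrers lam)"
      using ij by (cases "(i, j) \<in> ferrers lam"; cases "i' \<le> length lam") simp_all
  qed (auto simp: mem_ferrers)
  then have "addable_corner lam (length lam + 1, 1)"
    by (simp add: addable_corner_iff ferrers_def)
  note sub[OF row1] sub[OF this]
  \<comment> \<open>Here \<open>n \<ge> 1\<close> enters: for the empty partition both corners would
    be \<open>(1, 1)\<close>.\<close>
  moreover have "(1, row_len lam 1 + 1) \<noteq> (length lam + 1, 1)" using ne by simp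
  ultimately have "ferrers mu \<subseteq> ferrers lam" by blast
  then show ?thesis using partitions_eqI assms by blast
qed

section \<open>Chains in \<open>J_poset\<close>\<close>

lemma J_poset_nonmaximal:
  assumes "1 \<le> n" "X \<in> J_poset n" "Y \<in> J_poset n" "X \<subset> Y"
  shows "finite X" "card X \<in> {1, 2}"
proof -
  obtain S T where S: "S \<in> clique_complex n" "X = A_simplex n S"
    and T: "T \<in> clique_complex n" "Y = A_simplex n T"
    using assms by (auto simp: J_poset_def)
  obtain lam where lam: "lam \<in> S" using S by (auto simp: clique_complex_def)
  obtain mu where mu: "mu \<in> T" using T by (auto simp: clique_complex_def)
  have P: "lam \<in> partitions n" "mu \<in> partitions n"
    using lam mu S T by (auto simp: clique_complex_def)
  \<comment> \<open>If \<open>S\<close> were a single vertex, \<open>X\<close> would be all of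
    \<open>A_vertex n lam\<close> and lie inside \<open>A_vertex n mu\<close>. The antichain
    property gives \<open>lam = mu\<close>, hence \<open>Y \<subseteq> X\<close>.\<close>
  have "S \<noteq> {lam}"
  proof
    assume "S = {lam}"
    then have X: "X = A_vertex n lam" using S by (simp add: A_simplex_def)
    have Y: "Y \<subseteq> A_vertex n mu" using T mu by (auto simp: A_simplex_def)
    then have "lam = mu" using A_vertex_antichain[OF assms(1) P] assms(4) X by blast
    then show False using X Y assms(4) by blast
  qed
  then obtain lam' where lam': "lam' \<in> S" "lam \<noteq> lam'" using lam by blast
  then have "adjacent n lam lam'" using S lam by (auto simp: clique_complex_def)
  note sub = A_simplex_edge_subset[OF lam lam'(1) this, folded S(2)]
  then show fin: "finite X" by (rule finite_subset) simp
  have "card X \<le> 2" using card_mono[OF _ sub] by (simp add: card_insert_if split: if_splits)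
  moreover have "card X \<noteq> 0" using fin A_simplex_nonempty[OF S(1) lam lam'] S(2) by simp
  ultimately show "card X \<in> {1, 2}" by auto
qed

text \<open>Below the largest member \<open>M\<close>, comparable finite sets of equal cardinality
  coincide, so cardinality embeds \<open>T - {M}\<close> into \<open>{1, 2}\<close>.\<close>

lemma card_chain_J_poset:
  assumes "1 \<le> n" "finite T" "subset.chain (J_poset n) T"
  shows "card T \<le> 3"
proof (cases "T = {}")
  case False
  have J: "T \<subseteq> J_poset n" and tot: "\<And>X Y. X \<in> T \<Longrightarrow> Y \<in> T \<Longrightarrow> X \<subseteq> Y \<or> Y \<subseteq> X"
    using assms(3) by (auto simp: subset.chain_def)
  obtain M where M: "M \<in> T" "\<And>X. X \<in> T \<Longrightarrow> \<not> M \<subset> X"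
    using finite_has_maximal[OF assms(2) False] by blast
  have *: "finite X" "card X \<in> {1, 2}" if "X \<in> T - {M}" for X
  proof -
    have "X \<subset> M" using tot[of X M] M that by blast
    then show "finite X" "card X \<in> {1, 2}"
      using J_poset_nonmaximal[OF assms(1), of X M] J M that by auto
  qed
  have "inj_on card (T - {M})"
  proof (rule inj_onI)
    fix X Y assume "X \<in> T - {M}" "Y \<in> T - {M}" "card X = card Y"
    then show "X = Y"
      using tot[of X Y] *(1) card_subset_eq[of X Y] card_subset_eq[of Y X] by auto
  qed
  then have "card (T - {M}) \<le> card {1, 2 :: nat}"
    by (rule card_inj_on_le) (use * in auto)
  then show ?thesis using card_Diff_singleton[OF M(1)] by simp
qed simp

theorem theorem5p15:
  fixes n :: nat
  assumes "n \<ge> 1"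
  shows "(\<forall>(r::nat) (X :: nat \<Rightarrow> nat list set set).
            (\<forall>i\<le>r. X i \<in> J_poset n) \<and> (\<forall>i<r. X i \<subset> X (Suc i)) \<longrightarrow> r \<le> 2)
         \<and> complex_dim (order_complex (J_poset n)) \<le> 2"
proof (intro conjI allI impI)
  fix r :: nat and X :: "nat \<Rightarrow> nat list set set"
  assume X: "(\<forall>i\<le>r. X i \<in> J_poset n) \<and> (\<forall>i<r. X i \<subset> X (Suc i))"
  have c: "finite (X i)" "card (X i) \<in> {1, 2}" if "i < r" for i
    using J_poset_nonmaximal[OF assms, of "X i" "X (Suc i)"] X that by auto
  show "r \<le> 2"
  proof (rule ccontr)
    assume "\<not> r \<le> 2"
    \<comment> \<open>As \<open>2 < r\<close>, the set \<open>X 2\<close> also has a strict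
      successor, so three strictly increasing cardinalities would have to fit into
      \<open>{1, 2}\<close>.\<close>
    then have "X 0 \<subset> X 1" "X 1 \<subset> X 2" and r: "0 < r" "1 < r" "2 < r"
      using X by (auto simp: numeral_2_eq_2)
    then have "card (X 0) < card (X 1)" "card (X 1) < card (X 2)"
      using c(1) by (auto intro: psubset_card_mono)
    then show False using c(2)[OF r(1)] c(2)[OF r(3)] by auto
  qed
next
  show "complex_dim (order_complex (J_poset n)) \<le> 2"
    unfolding complex_dim_def
  proof (rule SUP_least)
    fix T assume "T \<in> order_complex (J_poset n)"
    then have "card T \<le> 3"
      using card_chain_J_poset[OF assms] by (auto simp: order_complex_def)
    then have "ereal (real (card T) - 1) \<le> ereal 2" by simp
    then show "ereal (real (card T) - 1) \<le> 2" by simp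
  qed
qed

end
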